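(* Let $T$ be an irreducible $n\times n$ matrix with entries in $\{0,1\}$ whose largest eigenvalue $\lambda$ satisfies $\lambda>1$, and let $\Sigma$ be the associated subshift of finite type. Let $S_1,S_2,\dots$ be a sequence of nonempty finite sets of finite admissible nonempty words such that, for each $i$, no word in $S_i$ contains another word in $S_i$. Let $\ell_i$ denote the minimal length of an element of $S_i$, and assume $\ell_i\to\infty$ as $i\to\infty$. Suppose there exists a real number $\kappa$ with $0<\kappa<\lambda$ such that $|S_i|=O(\kappa^{\ell_i})$ as $i\to\infty$. Then $$h(\Sigma)=\lim_{i\to\infty}h(\Sigma\langle S_i\rangle).$$
   Context: The subshift $\Sigma$ is the set of all bi-infinite strings $(x_i)_{i\in\mathbb{Z}}$ on the alphabet $\{1,\dots,n\}$ (indexing the rows and columns of $T$) such that the $(x_{i+1},x_i)$ entry of $T$ equals $1$ for all $i\in\mathbb{Z}$, with the shift map. A finite word is admissible if all its consecutive pairs of symbols satisfy this same condition. A word contains another if the latter occurs in it as a block of consecutive symbols. For a finite set $S$ of words, $|S|$ is its cardinality and $\Sigma\langle S\rangle$ is the subshift of $\Sigma$ consisting of those elements of $\Sigma$ in which none of the words of $S$ appears. For a subshift $X$, $h(X)$ denotes the topological entropy of the shift map on $X$ (natural logarithm). One has $\lambda=e^{h(\Sigma)}$. *)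

theory Defs
  imports
    "HOL-Analysis.Analysis"
    "HOL-Library.Landau_Symbols"
    "HOL-Library.Sublist"
    "Jordan_Normal_Form.Spectral_Radius"
begin

section \<open>Zero-one matrices\<close>

definition zero_one_mat :: "nat \<Rightarrow> real mat \<Rightarrow> bool" where
  "zero_one_mat n T \<longleftrightarrow> T \<in> carrier_mat n n \<and> (\<forall>i<n. \<forall>j<n. T $$ (i, j) \<in> {0, 1})"

text \<open>Irreducibility of a nonnegative square matrix.\<close>

definition irreducible_mat :: "real mat \<Rightarrow> bool" where
  "irreducible_mat T \<longleftrightarrow>
     (\<forall>i<dim_row T. \<forall>j<dim_row T. \<exists>k>0. (T ^\<^sub>m k) $$ (i, j) > 0)"

text \<open>
  The real number \<open>r\<close> is an eigenvalue, and no complex eigenvalue exceeds it in modulus. For a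
  nonnegative square matrix of positive dimension there is exactly one such \<open>r\<close>, by the
  Perron-Frobenius theorem.
\<close>

definition largest_eigenvalue :: "real mat \<Rightarrow> real \<Rightarrow> bool" where
  "largest_eigenvalue T r \<longleftrightarrow>
     eigenvalue (map_mat complex_of_real T) (complex_of_real r) \<and>
     (\<forall>\<mu>. eigenvalue (map_mat complex_of_real T) \<mu> \<longrightarrow> cmod \<mu> \<le> r)"


section \<open>Subshifts\<close>

text \<open>
  Matrix indices start at 0, so the alphabet is \<open>{0..<n}\<close>, where \<open>n\<close> is the dimension of the
  matrix. In the transition from \<open>x i\<close> to \<open>x (i + 1)\<close> the target is the row index.
\<close>

definition sft :: "real mat \<Rightarrow> (int \<Rightarrow> nat) set" where
  "sft T = {x. (\<forall>i. x i < dim_row T) \<and> (\<forall>i. T $$ (x (i + 1), x i) = 1)}"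

definition admissible :: "real mat \<Rightarrow> nat list \<Rightarrow> bool" where
  "admissible T w \<longleftrightarrow>
     (\<forall>a\<in>set w. a < dim_row T) \<and> (\<forall>k. Suc k < length w \<longrightarrow> T $$ (w ! Suc k, w ! k) = 1)"

definition appears_in :: "nat list \<Rightarrow> (int \<Rightarrow> nat) \<Rightarrow> bool" where
  "appears_in w x \<longleftrightarrow> (\<exists>i. \<forall>k<length w. x (i + int k) = w ! k)"

definition avoiding :: "(int \<Rightarrow> nat) set \<Rightarrow> nat list set \<Rightarrow> (int \<Rightarrow> nat) set" where
  "avoiding X S = {x \<in> X. \<forall>w\<in>S. \<not> appears_in w x}"

definition shift_map :: "(int \<Rightarrow> nat) \<Rightarrow> (int \<Rightarrow> nat)" where
  "shift_map x = (\<lambda>i. x (i + 1))"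


section \<open>Topological entropy\<close>

text \<open>
  The definition of Adler, Konheim and McAndrew via open covers, for a continuous self-map \<open>f\<close>
  of a compact space \<open>X\<close>.
\<close>

definition open_cover :: "'a topology \<Rightarrow> 'a set set \<Rightarrow> bool" where
  "open_cover X \<U> \<longleftrightarrow> (\<forall>U\<in>\<U>. openin X U) \<and> \<Union>\<U> = topspace X"

definition min_subcover_card :: "'a topology \<Rightarrow> 'a set set \<Rightarrow> nat" where
  "min_subcover_card X \<U> =
     (LEAST m. \<exists>\<V>\<subseteq>\<U>. finite \<V> \<and> \<Union>\<V> = topspace X \<and> card \<V> = m)"

text \<open>The common refinement of the preimages of \<open>\<U>\<close> under the first \<open>k\<close> iterates of \<open>f\<close>.\<close>

definition iterated_join :: "'a topology \<Rightarrow> ('a \<Rightarrow> 'a) \<Rightarrow> 'a set set \<Rightarrow> nat \<Rightarrow> 'a set set" where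
  "iterated_join X f \<U> k =
     {{x \<in> topspace X. \<forall>j<k. (f ^^ j) x \<in> c j} | c :: nat \<Rightarrow> 'a set. \<forall>j<k. c j \<in> \<U>}"

text \<open>
  By subadditivity the limit superior is a limit. The empty space gets entropy 0, because
  \<open>ln 0 = 0\<close>.
\<close>

definition cover_entropy :: "'a topology \<Rightarrow> ('a \<Rightarrow> 'a) \<Rightarrow> 'a set set \<Rightarrow> ereal" where
  "cover_entropy X f \<U> =
     limsup (\<lambda>k. ereal (ln (real (min_subcover_card X (iterated_join X f \<U> k))) / real k))"

definition topological_entropy :: "'a topology \<Rightarrow> ('a \<Rightarrow> 'a) \<Rightarrow> ereal" where
  "topological_entropy X f = (SUP \<U>\<in>{\<U>. open_cover X \<U>}. cover_entropy X f \<U>)"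

text \<open>
  The topology on \<^typ>\<open>int \<Rightarrow> nat\<close> is the product topology, with \<^typ>\<open>nat\<close> discrete; a subshift
  carries the subspace topology.
\<close>

definition shift_entropy :: "(int \<Rightarrow> nat) set \<Rightarrow> ereal" where
  "shift_entropy X = topological_entropy (top_of_set X) shift_map"

end

theory Submission
  imports Defs
begin

text \<open>
  The entropy of a subshift is the exponential growth rate of the number of its words. For every
  set \<open>S\<close> of forbidden words the entropy is at most \<open>ln r\<close>, because the number of admissible words of
  length \<open>m\<close> is at most a constant times \<open>\<rho> ^ m\<close> for each \<open>\<rho> > r\<close>, as the powers of \<open>T\<close> show
  (\<open>shift_entropy_avoiding_le\<close>). The point is a matching lower bound when the forbidden words are
  long and few.

  Give each admissible word that avoids \<open>S\<close> the weight \<open>v a\<close> of its first letter \<open>a\<close>, where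
  \<open>v > 0\<close> satisfies \<open>r v \<le> T v\<close> (\<open>exists_positive_subeigenvector\<close>), and let \<open>A m\<close> be the total
  weight at length \<open>m\<close>. Prepending letters in all admissible ways multiplies the total weight by
  \<open>r\<close> or more. An extension that no longer avoids \<open>S\<close> begins with some \<open>s \<in> S\<close> and continues with an
  avoiding word, so up to a constant factor \<open>M\<close>

    \<open>A (m + 1) \<ge> r A m - M (\<Sum>s\<in>S. A (m + 1 - length s))\<close>.

  If all words of \<open>S\<close> have length at least \<open>l\<close> and \<open>1 \<le> \<beta> < r\<close>, then induction gives
  \<open>A (m + 1) \<ge> \<beta> A m\<close> as soon as \<open>card S\<close> is at most a small multiple of \<open>\<beta> ^ l\<close>
  (\<open>card_avoiding_words_lower\<close>). For a given \<open>\<beta> < r\<close> above \<open>1\<close> and \<open>\<kappa>\<close> this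
  holds for all late members of a sequence of forbidden sets with \<open>card S = O(\<kappa> ^ l)\<close> and \<open>l \<longlongrightarrow> \<infinity>\<close>.

  It remains to pass from avoiding words to words that occur in points of the subshift. By
  compactness a block far from both ends of an avoiding word occurs in a point, and a subdivision of
  long words into blocks shows that the growth rate is the same (\<open>card_language_lower\<close>). Hence the
  entropies are eventually at least \<open>ln \<beta>\<close>. Since \<open>\<beta> < r\<close> was arbitrary, they converge to \<open>ln r\<close>,
  which is the entropy of the unrestricted subshift by the same bounds with \<open>S\<close> empty.
\<close>

section \<open>Admissible words that avoid a set of words\<close>

definition avoiding_words :: "real mat \<Rightarrow> nat list set \<Rightarrow> nat \<Rightarrow> nat list set" where
  "avoiding_words T S m = {w. length w = m \<and> admissible T w \<and> (\<forall>s\<in>S. \<not> sublist s w)}"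

lemma admissible_sublist:
  assumes "admissible T w" "sublist u w"
  shows "admissible T u"
proof -
  obtain p q where w: "w = p @ u @ q" using assms(2) by (auto simp: sublist_def)
  have "T $$ (u ! Suc k, u ! k) = 1" if "Suc k < length u" for k
  proof -
    have "Suc (length p + k) < length w" using that w by simp
    then have "T $$ (w ! Suc (length p + k), w ! (length p + k)) = 1"
      using assms(1) unfolding admissible_def by blast
    then show ?thesis using that by (simp add: w nth_append)
  qed
  then show ?thesis using assms(1) by (auto simp: admissible_def w)
qed

lemma admissible_Nil: "admissible T []"
  by (simp add: admissible_def)

lemma admissible_Cons:
  "admissible T (a # w) \<longleftrightarrow>
     a < dim_row T \<and> (w \<noteq> [] \<longrightarrow> T $$ (hd w, a) = 1) \<and> admissible T w"
proof (cases w)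
  case (Cons c u)
  have "(\<forall>k. Suc k < length (a # w) \<longrightarrow> T $$ ((a # w) ! Suc k, (a # w) ! k) = 1) \<longleftrightarrow>
        T $$ (c, a) = 1 \<and> (\<forall>k. Suc k < length w \<longrightarrow> T $$ (w ! Suc k, w ! k) = 1)" (is "?l = ?r")
  proof
    assume l: ?l
    show ?r
    proof (intro conjI allI impI)
      show "T $$ (c, a) = 1" using l[rule_format, of 0] Cons by simp
      show "T $$ (w ! Suc k, w ! k) = 1" if "Suc k < length w" for k
        using l[rule_format, of "Suc k"] that by simp
    qed
  next
    assume r: ?r
    show ?l
    proof (intro allI impI)
      fix k assume "Suc k < length (a # w)"
      then show "T $$ ((a # w) ! Suc k, (a # w) ! k) = 1" using r Cons by (cases k) auto
    qed
  qed
  then show ?thesis unfolding admissible_def using Cons by auto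
qed (auto simp: admissible_def)

lemma avoiding_words_sublist:
  assumes "w \<in> avoiding_words T S m" "sublist u w"
  shows "u \<in> avoiding_words T S (length u)"
  using assms admissible_sublist sublist_order.order.trans unfolding avoiding_words_def by blast

lemma avoiding_words_subset_lists:
  "avoiding_words T S m \<subseteq> {w. set w \<subseteq> {..<dim_row T} \<and> length w = m}"
  by (auto simp: avoiding_words_def admissible_def)

lemma finite_avoiding_words: "finite (avoiding_words T S m)"
  by (rule finite_subset[OF avoiding_words_subset_lists]) (simp add: finite_lists_length_eq)

section \<open>Perron-Frobenius estimates\<close>

text \<open>
  Take an eigenvector \<open>z\<close> for \<open>r\<close>. By the triangle inequality the vector \<open>u\<close> of absolute values
  satisfies \<open>r u \<le> T u\<close>, and so do all \<open>T\<^sup>k u\<close>, because \<open>T\<close> is nonnegative. Irreducibility spreads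
  a positive entry of \<open>u\<close> to every coordinate, so a sum of enough of the vectors \<open>T\<^sup>k u\<close> is
  positive. The inequality is as good as the eigenvector equation here: it is only used for
  lower bounds.
\<close>

lemma exists_positive_subeigenvector:
  assumes T: "zero_one_mat n T" "irreducible_mat T"
    and ev: "eigenvalue (map_mat complex_of_real T) (complex_of_real r)" and r: "r \<ge> 0"
  obtains v where "\<And>a. a < n \<Longrightarrow> v a > 0"
    and "\<And>c. c < n \<Longrightarrow> r * v c \<le> (\<Sum>a<n. T $$ (c, a) * v a)" and "n > 0"
proof -
  have T01: "T $$ (i, j) \<ge> 0" if "i < n" "j < n" for i j
    using T(1) that unfolding zero_one_mat_def by force
  have carr: "T \<in> carrier_mat n n" using T(1) unfolding zero_one_mat_def by simp
  then have dim[simp]: "dim_row T = n" "dim_col T = n" by auto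
  have pcarr: "T ^\<^sub>m k \<in> carrier_mat n n" for k using carr by simp
  then have pdim[simp]: "dim_row (T ^\<^sub>m k) = n" "dim_col (T ^\<^sub>m k) = n" for k by auto
  have mult: "(A * B) $$ (i, j) = (\<Sum>l<n. A $$ (i, l) * B $$ (l, j))"
    if "A \<in> carrier_mat n n" "B \<in> carrier_mat n n" "i < n" "j < n" for A B :: "real mat" and i j
    using that by (auto simp: scalar_prod_def lessThan_atLeast0 intro!: sum.cong)
  obtain z where z: "z \<in> carrier_vec n" "z \<noteq> 0\<^sub>v n"
    and zeq: "map_mat complex_of_real T *\<^sub>v z = complex_of_real r \<cdot>\<^sub>v z"
    using ev unfolding eigenvalue_def eigenvector_def by auto
  define u where "u a = cmod (vec_index z a)" for a :: nat
  have u0: "u a \<ge> 0" for a by (simp add: u_def)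
  obtain j0 where j0: "j0 < n" "u j0 > 0"
    using z unfolding u_def by (metis carrier_vecD eq_vecI index_zero_vec zero_less_norm_iff)
  have usub: "r * u c \<le> (\<Sum>a<n. T $$ (c, a) * u a)" if c: "c < n" for c
  proof -
    have "complex_of_real r * vec_index z c = (\<Sum>a<n. complex_of_real (T $$ (c, a)) * vec_index z a)"
      using arg_cong[OF zeq, of "\<lambda>x. vec_index x c"] c z(1)
      by (auto simp: scalar_prod_def lessThan_atLeast0)
    then have "r * u c = cmod (\<Sum>a<n. complex_of_real (T $$ (c, a)) * vec_index z a)"
      using r by (metis abs_of_nonneg norm_mult norm_of_real u_def)
    also have "\<dots> \<le> (\<Sum>a<n. cmod (complex_of_real (T $$ (c, a)) * vec_index z a))"
      by (rule norm_sum)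
    also have "\<dots> = (\<Sum>a<n. T $$ (c, a) * u a)"
      using T01 c by (auto simp: u_def norm_mult intro!: sum.cong)
    finally show ?thesis .
  qed
  have p0: "(T ^\<^sub>m k) $$ (i, j) \<ge> 0" if "i < n" "j < n" for i j k
    using that
  proof (induction k arbitrary: i j)
    case (Suc k)
    have "(T ^\<^sub>m Suc k) $$ (i, j) = (\<Sum>l<n. (T ^\<^sub>m k) $$ (i, l) * T $$ (l, j))"
      unfolding pow_mat.simps by (rule mult[OF pcarr carr Suc.prems])
    also have "\<dots> \<ge> 0"
      using Suc T01 by (intro sum_nonneg mult_nonneg_nonneg) auto
    finally show ?case .
  qed simp
  have comm: "T * T ^\<^sub>m k = T ^\<^sub>m k * T" for k
  proof (induction k)
    case (Suc k)
    have "T * T ^\<^sub>m (Suc k) = T * T ^\<^sub>m k * T" using carr pcarr by (simp add: assoc_mult_mat[of _ n n _ n _ n])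
    then show ?case using Suc by simp
  qed (use carr in simp)
  define P where "P k i = (\<Sum>j<n. (T ^\<^sub>m k) $$ (i, j) * u j)" for k i
  have Psub: "r * P k c \<le> (\<Sum>a<n. T $$ (c, a) * P k a)" if c: "c < n" for k c
  proof -
    have "r * P k c = (\<Sum>j<n. (T ^\<^sub>m k) $$ (c, j) * (r * u j))"
      by (simp add: P_def sum_distrib_left mult_ac)
    also have "\<dots> \<le> (\<Sum>j<n. (T ^\<^sub>m k) $$ (c, j) * (\<Sum>a<n. T $$ (j, a) * u a))"
      using usub p0 c by (intro sum_mono mult_left_mono) auto
    also have "\<dots> = (\<Sum>a<n. (T ^\<^sub>m k * T) $$ (c, a) * u a)"
      using mult[OF pcarr carr c]
      by (simp add: sum_distrib_left sum_distrib_right mult.assoc del: index_mult_mat) (rule sum.swap)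
    also have "\<dots> = (\<Sum>a<n. (T * T ^\<^sub>m k) $$ (c, a) * u a)" by (simp add: comm)
    also have "\<dots> = (\<Sum>a<n. T $$ (c, a) * P k a)"
      using mult[OF carr pcarr c] unfolding P_def
      by (simp add: sum_distrib_left sum_distrib_right mult.assoc del: index_mult_mat) (rule sum.swap)
    finally show ?thesis .
  qed
  have "\<forall>i<n. \<exists>k. (T ^\<^sub>m k) $$ (i, j0) > 0"
    using T(2) j0 unfolding irreducible_mat_def by auto
  then obtain K where K: "\<And>i. i < n \<Longrightarrow> (T ^\<^sub>m K i) $$ (i, j0) > 0" by metis
  define N where "N = Max (K ` {..<n})"
  have KN: "K i \<le> N" if "i < n" for i unfolding N_def using that by simp
  define v where "v i = (\<Sum>k\<le>N. P k i)" for i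
  have P0: "P k i \<ge> 0" if "i < n" for k i
    unfolding P_def using that p0 u0 by (intro sum_nonneg mult_nonneg_nonneg) auto
  have "v a > 0" if a: "a < n" for a
  proof -
    have "0 < (T ^\<^sub>m K a) $$ (a, j0) * u j0" using K a j0 by simp
    also have "\<dots> \<le> P (K a) a"
      unfolding P_def using a p0 u0 j0
      by (intro member_le_sum) (auto intro!: mult_nonneg_nonneg)
    also have "\<dots> \<le> v a"
      unfolding v_def using a P0 KN by (intro member_le_sum) auto
    finally show ?thesis .
  qed
  moreover have "r * v c \<le> (\<Sum>a<n. T $$ (c, a) * v a)" if c: "c < n" for c
  proof -
    have "r * v c \<le> (\<Sum>k\<le>N. \<Sum>a<n. T $$ (c, a) * P k a)"
      unfolding v_def sum_distrib_left using Psub c by (intro sum_mono) auto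
    also have "\<dots> = (\<Sum>a<n. T $$ (c, a) * v a)"
      by (subst sum.swap) (simp add: v_def sum_distrib_left)
    finally show ?thesis .
  qed
  ultimately show ?thesis using that j0 by auto
qed

text \<open>
  The spectral radius of \<open>T / \<rho>\<close> is below 1, so the powers of this matrix stay bounded.
\<close>

lemma matrix_powers_bound:
  assumes T: "T \<in> carrier_mat n n" and n: "n > 0"
    and le: "largest_eigenvalue T r" and \<rho>: "r < \<rho>" "0 < \<rho>"
  obtains C where "\<And>k i j. i < n \<Longrightarrow> j < n \<Longrightarrow> \<bar>(T ^\<^sub>m k) $$ (i, j)\<bar> \<le> C * \<rho> ^ k"
proof -
  let ?T = "map_mat complex_of_real T"
  define A where "A = complex_of_real (1 / \<rho>) \<cdot>\<^sub>m ?T"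
  have A: "A \<in> carrier_mat n n" using T by (simp add: A_def)
  have "spectral_radius A < 1"
  proof -
    obtain \<mu> where \<mu>: "eigenvalue A \<mu>" "spectral_radius A = cmod \<mu>"
      using spectral_radius_mem_max(1)[OF A n] by (auto simp: spectrum_def)
    obtain z where z: "z \<in> carrier_vec n" "z \<noteq> 0\<^sub>v n" "A *\<^sub>v z = \<mu> \<cdot>\<^sub>v z"
      using \<mu>(1) A unfolding eigenvalue_def eigenvector_def by auto
    have "?T *\<^sub>v z = complex_of_real \<rho> \<cdot>\<^sub>v (A *\<^sub>v z)"
      using T z(1) \<rho> by (intro eq_vecI) (auto simp: A_def scalar_prod_def sum_distrib_left intro!: sum.cong)
    also have "\<dots> = (complex_of_real \<rho> * \<mu>) \<cdot>\<^sub>v z" using z by (simp add: smult_smult_assoc)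
    finally have "eigenvalue ?T (complex_of_real \<rho> * \<mu>)"
      unfolding eigenvalue_def eigenvector_def using z T by auto
    then have "cmod (complex_of_real \<rho> * \<mu>) \<le> r" using le unfolding largest_eigenvalue_def by blast
    then have "\<rho> * cmod \<mu> \<le> r" using \<rho> by (simp add: norm_mult)
    then have "\<rho> * cmod \<mu> < \<rho> * 1" using \<rho> by linarith
    then show ?thesis unfolding \<mu>(2) mult_less_cancel_left_pos[OF \<rho>(2)] .
  qed
  then obtain C where C: "\<And>k. norm_bound (A ^\<^sub>m k) C"
    using spectral_radius_jnf_norm_bound_less_1_upper_triangular[OF A] by blast
  have pT: "T ^\<^sub>m k \<in> carrier_mat n n" for k using T by simp
  have pA: "A ^\<^sub>m k = complex_of_real (1 / \<rho> ^ k) \<cdot>\<^sub>m map_mat complex_of_real (T ^\<^sub>m k)" for k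
  proof (induction k)
    case (Suc k)
    have entry: "A $$ (l, j) = complex_of_real (1 / \<rho>) * complex_of_real (T $$ (l, j))"
      if "l < n" "j < n" for l j
      using that T by (simp add: A_def)
    have dims: "dim_row A = n" "dim_col A = n" "dim_row T = n" "dim_col T = n"
      "dim_row (T ^\<^sub>m k) = n" "dim_col (T ^\<^sub>m k) = n"
      using A T pT[of k] by auto
    show ?case
      using dims by (intro eq_matI) (auto simp: Suc entry scalar_prod_def sum_distrib_left mult_ac
          intro!: sum.cong)
  qed (use T A in auto)
  have "\<bar>(T ^\<^sub>m k) $$ (i, j)\<bar> \<le> C * \<rho> ^ k" if "i < n" "j < n" for k i j
  proof -
    have "cmod ((A ^\<^sub>m k) $$ (i, j)) \<le> C"
      using C[of k] A that unfolding norm_bound_def by (auto simp: pow_carrier_mat)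
    moreover have "(A ^\<^sub>m k) $$ (i, j) = complex_of_real ((T ^\<^sub>m k) $$ (i, j) / \<rho> ^ k)"
      using that carrier_matD[OF pT[of k]] by (simp add: pA)
    ultimately have "\<bar>(T ^\<^sub>m k) $$ (i, j) / \<rho> ^ k\<bar> \<le> C"
      by (simp only: norm_of_real)
    then show ?thesis using \<rho> by (simp add: abs_divide pos_divide_le_eq)
  qed
  then show ?thesis using that by blast
qed

text \<open>
  Prepending \<open>a\<close> to a word with first letter \<open>c\<close> is allowed exactly when \<open>T\<close> has a 1 at
  \<open>(c, a)\<close>, which is the recursion of the column sums of the powers of \<open>T\<close>.
\<close>

lemma card_words_from_letter:
  assumes T: "zero_one_mat n T" and a: "a < n"
  shows "real (card {w \<in> avoiding_words T {} (Suc k). hd w = a}) = (\<Sum>b<n. (T ^\<^sub>m k) $$ (b, a))"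
  using a
proof (induction k arbitrary: a)
  have carr: "T \<in> carrier_mat n n" using T unfolding zero_one_mat_def by simp
  then have [simp]: "dim_row T = n" "dim_col T = n" by auto
  {
    case 0
    have "{w \<in> avoiding_words T {} (Suc 0). hd w = a} = {[a]}"
      using 0 by (auto simp: avoiding_words_def admissible_Cons admissible_Nil length_Suc_conv)
    then show ?case using 0 by (simp add: if_distrib cong: if_cong)
  next
    case (Suc k)
    have pcarr: "T ^\<^sub>m k \<in> carrier_mat n n" using carr by simp
    let ?W = "\<lambda>c. {w \<in> avoiding_words T {} (Suc k). hd w = c}"
    have eq: "{w \<in> avoiding_words T {} (Suc (Suc k)). hd w = a} =
          (#) a ` (\<Union>c\<in>{c. c < n \<and> T $$ (c, a) = 1}. ?W c)" (is "?L = ?R")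
    proof (intro equalityI subsetI)
      fix w assume w: "w \<in> ?L"
      then obtain c u where "w = a # c # u" by (auto simp: avoiding_words_def length_Suc_conv)
      then show "w \<in> ?R" using w by (auto simp: avoiding_words_def admissible_Cons)
    next
      fix w assume "w \<in> ?R"
      then obtain c u where "w = a # u" "u \<in> ?W c" "T $$ (c, a) = 1" by auto
      then show "w \<in> ?L" using Suc.prems by (auto simp: avoiding_words_def admissible_Cons)
    qed
    have "card ?L = (\<Sum>c\<in>{c. c < n \<and> T $$ (c, a) = 1}. card (?W c))"
      unfolding eq by (subst card_image, simp, subst card_UN_disjoint)
        (auto intro: finite_subset[OF _ finite_avoiding_words[of T "{}" "Suc k"]])
    also have "real \<dots> = (\<Sum>c\<in>{c. c < n \<and> T $$ (c, a) = 1}. \<Sum>b<n. (T ^\<^sub>m k) $$ (b, c))"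
      using Suc.IH by simp
    also have "\<dots> = (\<Sum>c<n. T $$ (c, a) * (\<Sum>b<n. (T ^\<^sub>m k) $$ (b, c)))"
      using T Suc.prems unfolding zero_one_mat_def by (intro sum.mono_neutral_cong_left) auto
    also have "\<dots> = (\<Sum>b<n. \<Sum>c<n. (T ^\<^sub>m k) $$ (b, c) * T $$ (c, a))"
      by (subst sum.swap) (simp add: sum_distrib_left mult_ac)
    also have "\<dots> = (\<Sum>b<n. (T ^\<^sub>m Suc k) $$ (b, a))"
      using carr pcarr Suc.prems by (auto simp: scalar_prod_def lessThan_atLeast0 intro!: sum.cong)
    finally show ?case .
  }
qed

lemma card_admissible_words_upper:
  assumes T: "zero_one_mat n T" and n: "n > 0"
    and le: "largest_eigenvalue T r" and \<rho>: "r < \<rho>" "0 < \<rho>"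
  obtains C where "C > 0" and "\<And>m. real (card (avoiding_words T {} m)) \<le> C * \<rho> ^ m"
proof -
  have carr: "T \<in> carrier_mat n n" using T unfolding zero_one_mat_def by simp
  obtain C where C: "\<And>k i j. i < n \<Longrightarrow> j < n \<Longrightarrow> \<bar>(T ^\<^sub>m k) $$ (i, j)\<bar> \<le> C * \<rho> ^ k"
    using matrix_powers_bound[OF carr n le \<rho>] by metis
  define D where "D = max 1 (real n * (real n * C) / \<rho>)"
  have "real (card (avoiding_words T {} m)) \<le> D * \<rho> ^ m" for m
  proof (cases m)
    case 0
    have "avoiding_words T {} 0 = {[]}" by (auto simp: avoiding_words_def admissible_Nil)
    then show ?thesis by (simp add: 0 D_def)
  next
    case (Suc k)
    have "avoiding_words T {} (Suc k) \<subseteq> (\<Union>a<n. {w \<in> avoiding_words T {} (Suc k). hd w = a})"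
      using carr by (auto simp: avoiding_words_def length_Suc_conv admissible_Cons)
    then have "card (avoiding_words T {} (Suc k)) \<le> (\<Sum>a<n. card {w \<in> avoiding_words T {} (Suc k). hd w = a})"
      by (intro order.trans[OF card_mono card_UN_le]) (simp_all add: finite_avoiding_words)
    then have "real (card (avoiding_words T {} m))
        \<le> (\<Sum>a<n. real (card {w \<in> avoiding_words T {} (Suc k). hd w = a}))"
      unfolding Suc of_nat_sum[symmetric] by (rule of_nat_mono)
    also have "\<dots> = (\<Sum>a<n. \<Sum>b<n. (T ^\<^sub>m k) $$ (b, a))"
      using card_words_from_letter[OF T] by simp
    also have "\<dots> \<le> (\<Sum>a<n. \<Sum>b<n. C * \<rho> ^ k)"
      using C by (intro sum_mono) (meson abs_le_D1 lessThan_iff)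
    also have "\<dots> = real n * (real n * C) / \<rho> * \<rho> ^ m" using \<rho> Suc by simp
    also have "\<dots> \<le> D * \<rho> ^ m" unfolding D_def using \<rho> by (intro mult_right_mono) auto
    finally show ?thesis .
  qed
  moreover have "D > 0" by (simp add: D_def)
  ultimately show ?thesis using that by blast
qed

section \<open>Many words survive when few words are forbidden\<close>

text \<open>
  Words grow on the left, so the letter that matters for the next extension is the first one. The
  empty word can be extended by every letter and needs a weight of its own, small enough for the
  same growth inequality to hold.
\<close>

definition word_weight :: "(nat \<Rightarrow> real) \<Rightarrow> real \<Rightarrow> nat list \<Rightarrow> real" where
  "word_weight v \<delta> w = (if w = [] then \<delta> else v (hd w))"

definition total_weight ::
    "(nat \<Rightarrow> real) \<Rightarrow> real \<Rightarrow> real mat \<Rightarrow> nat list set \<Rightarrow> nat \<Rightarrow> real" where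
  "total_weight v \<delta> T S m = (\<Sum>w\<in>avoiding_words T S m. word_weight v \<delta> w)"

text \<open>
  Without the forbidden words, prepending a letter multiplies the total weight by at least \<open>r\<close>.
  What is lost are the words \<open>s @ u\<close> with \<open>s\<close> forbidden: a forbidden word in the extension of an
  avoiding word must be a prefix, and the rest \<open>u\<close> is again an avoiding word.
\<close>

lemma total_weight_step:
  fixes v :: "nat \<Rightarrow> real"
  assumes T: "zero_one_mat n T"
    and vpos: "\<And>a. a < n \<Longrightarrow> 0 < v a" and vM: "\<And>a. a < n \<Longrightarrow> v a \<le> M"
    and sub: "\<And>c. c < n \<Longrightarrow> r * v c \<le> (\<Sum>a<n. T $$ (c, a) * v a)"
    and n: "n > 0" and \<delta>: "\<And>a. a < n \<Longrightarrow> r * \<delta> \<le> v a" "\<delta> > 0"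
    and S: "finite S" "\<And>s. s \<in> S \<Longrightarrow> s \<noteq> []"
  shows "r * total_weight v \<delta> T S m \<le> total_weight v \<delta> T S (Suc m) +
     M * (\<Sum>s\<in>{s\<in>S. length s \<le> Suc m}. real (card (avoiding_words T S (Suc m - length s))))"
proof -
  have dim: "dim_row T = n" using T unfolding zero_one_mat_def by auto
  let ?G = "avoiding_words T S"
  let ?S = "{s\<in>S. length s \<le> Suc m}"
  let ?B = "\<Union>s\<in>?S. (\<lambda>u. s @ u) ` ?G (Suc m - length s)"
  define E where "E = (\<lambda>(w, a). a # w) ` (SIGMA w:?G m. {a. admissible T (a # w)})"
  have fin: "finite {a. admissible T (a # w)}" for w
    by (rule finite_subset[of _ "{..<n}"]) (auto simp: admissible_Cons dim)
  have finE: "finite E" unfolding E_def by (intro finite_imageI finite_SigmaI finite_avoiding_words fin)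
  have finB: "finite ?B" using S finite_avoiding_words by auto
  have hdE: "w \<noteq> []" "hd w < n" if "w \<in> E" for w
    using that by (auto simp: E_def admissible_Cons dim)
  have split: "E \<subseteq> ?G (Suc m) \<union> ?B"
  proof
    fix w assume "w \<in> E"
    then obtain u a where w: "w = a # u" "u \<in> ?G m" "admissible T (a # u)" by (auto simp: E_def)
    show "w \<in> ?G (Suc m) \<union> ?B"
    proof (cases "\<exists>s\<in>S. sublist s w")
      case False
      then show ?thesis using w by (auto simp: avoiding_words_def)
    next
      case True
      then obtain s where s: "s \<in> S" "sublist s (a # u)" using w by auto
      \<comment> \<open>The tail avoids \<open>S\<close>, so the forbidden word sits at the very beginning.\<close>
      moreover have "\<not> sublist s u" using w s by (auto simp: avoiding_words_def)
      ultimately have "prefix s (a # u)" by (auto simp: sublist_Cons_right)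
      then obtain t where t: "a # u = s @ t" by (auto simp: prefix_def)
      obtain c q where "s = c # q" using S(2)[OF s(1)] by (cases s) auto
      then have "u = q @ t" using t by simp
      then have "t \<in> ?G (length t)"
        using avoiding_words_sublist[OF w(2), of t] by (simp add: sublist_append_rightI)
      moreover have "Suc m = length s + length t"
        using arg_cong[OF t, of length] w(2) by (simp add: avoiding_words_def)
      ultimately show ?thesis using s(1) t w(1) by force
    qed
  qed
  have "r * total_weight v \<delta> T S m = (\<Sum>w\<in>?G m. r * word_weight v \<delta> w)"
    by (simp add: total_weight_def sum_distrib_left)
  also have "\<dots> \<le> (\<Sum>w\<in>?G m. \<Sum>a\<in>{a. admissible T (a # w)}. v a)"
  proof (rule sum_mono)
    fix w assume w: "w \<in> ?G m"
    show "r * word_weight v \<delta> w \<le> (\<Sum>a\<in>{a. admissible T (a # w)}. v a)"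
    proof (cases w)
      case Nil
      have "r * \<delta> \<le> v 0" using \<delta> n by blast
      also have "\<dots> \<le> (\<Sum>a<n. v a)" using n vpos by (intro member_le_sum) (auto simp: less_imp_le)
      also have "{..<n} = {a. admissible T (a # w)}"
        by (auto simp: Nil admissible_Cons admissible_Nil dim)
      finally show ?thesis by (simp add: word_weight_def Nil)
    next
      case (Cons c u)
      have c: "c < n" and adm: "admissible T w"
        using w Cons by (auto simp: avoiding_words_def admissible_Cons dim)
      have "r * v c \<le> (\<Sum>a<n. T $$ (c, a) * v a)" by (rule sub[OF c])
      also have "\<dots> = (\<Sum>a\<in>{a. admissible T (a # w)}. v a)"
        using T c adm unfolding zero_one_mat_def
        by (intro sum.mono_neutral_cong_right) (auto simp: Cons admissible_Cons[of _ _ "c # u"] dim)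
      finally show ?thesis by (simp add: word_weight_def Cons)
    qed
  qed
  also have "\<dots> = (\<Sum>(w, a)\<in>(SIGMA w:?G m. {a. admissible T (a # w)}). v a)"
    using finite_avoiding_words fin by (intro sum.Sigma) auto
  also have "\<dots> = (\<Sum>w\<in>E. v (hd w))"
    unfolding E_def by (subst sum.reindex) (auto simp: inj_on_def case_prod_unfold)
  also have "\<dots> = (\<Sum>w\<in>E \<inter> ?G (Suc m). v (hd w)) + (\<Sum>w\<in>E - ?G (Suc m). v (hd w))"
    using sum.Int_Diff[OF finE] by blast
  also have "(\<Sum>w\<in>E \<inter> ?G (Suc m). v (hd w)) = (\<Sum>w\<in>E \<inter> ?G (Suc m). word_weight v \<delta> w)"
    using hdE by (intro sum.cong) (auto simp: word_weight_def)
  also have "\<dots> \<le> total_weight v \<delta> T S (Suc m)"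
    unfolding total_weight_def
  proof (intro sum_mono2 finite_avoiding_words)
    fix w assume "w \<in> ?G (Suc m) - E \<inter> ?G (Suc m)"
    then show "0 \<le> word_weight v \<delta> w"
      using vpos \<delta>(2) by (cases w) (auto simp: word_weight_def avoiding_words_def admissible_Cons dim less_imp_le)
  qed simp
  also have "(\<Sum>w\<in>E - ?G (Suc m). v (hd w)) \<le> (\<Sum>w\<in>E - ?G (Suc m). M)"
    using hdE vM by (intro sum_mono) auto
  also have "\<dots> = M * real (card (E - ?G (Suc m)))" by simp
  also have "\<dots> \<le> M * real (\<Sum>s\<in>?S. card (?G (Suc m - length s)))"
  proof (intro mult_left_mono)
    have "card (E - ?G (Suc m)) \<le> card ?B" using split by (intro card_mono finB) auto
    also have "\<dots> \<le> (\<Sum>s\<in>?S. card ((\<lambda>u. s @ u) ` ?G (Suc m - length s)))"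
      using S by (intro card_UN_le) auto
    also have "\<dots> \<le> (\<Sum>s\<in>?S. card (?G (Suc m - length s)))"
      by (intro sum_mono card_image_le finite_avoiding_words)
    finally show "real (card (E - ?G (Suc m))) \<le> real (\<Sum>s\<in>?S. card (?G (Suc m - length s)))"
      by (rule of_nat_mono)
    show "0 \<le> M" using vpos[OF n] vM[OF n] by simp
  qed
  finally show ?thesis by simp
qed

text \<open>
  The total weight grows at least by the factor \<open>\<beta>\<close> in each step, by strong induction: if it did so
  up to length \<open>m\<close>, then at length \<open>m + 1 - length s\<close> it was smaller than at length \<open>m\<close> by at least the
  factor \<open>\<beta> ^ (length s - 1)\<close>, so that each forbidden word \<open>s\<close> costs little and together they cost
  at most \<open>r - \<beta>\<close> times the current weight.
\<close>

lemma card_avoiding_words_lower: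
  fixes v :: "nat \<Rightarrow> real"
  assumes T: "zero_one_mat n T"
    and vpos: "\<And>a. a < n \<Longrightarrow> 0 < v a" and vM: "\<And>a. a < n \<Longrightarrow> v a \<le> M"
    and sub: "\<And>c. c < n \<Longrightarrow> r * v c \<le> (\<Sum>a<n. T $$ (c, a) * v a)"
    and n: "n > 0" and \<delta>: "\<And>a. a < n \<Longrightarrow> r * \<delta> \<le> v a" "\<delta> > 0"
    and S: "finite S" "\<And>s. s \<in> S \<Longrightarrow> s \<noteq> []" "\<And>s. s \<in> S \<Longrightarrow> l \<le> length s"
    and \<beta>: "1 \<le> \<beta>" "\<beta> \<le> r" and few: "real (card S) * M * \<beta> \<le> (r - \<beta>) * \<delta> * \<beta> ^ l"
  shows "\<delta> * \<beta> ^ m \<le> M * real (card (avoiding_words T S m))"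
proof -
  have dim: "dim_row T = n" using T unfolding zero_one_mat_def by auto
  let ?a = "total_weight v \<delta> T S"
  have d1: "\<delta> \<le> v a" if "a < n" for a
    using \<delta>(1)[OF that] mult_right_mono[of 1 r \<delta>] \<beta> \<delta>(2) by linarith
  have M: "\<delta> \<le> M" using d1[OF n] vM[OF n] by linarith
  have wt: "\<delta> \<le> word_weight v \<delta> w" "word_weight v \<delta> w \<le> M" if "w \<in> avoiding_words T S k" for w k
    using that d1 M vM by (cases w; auto simp: word_weight_def avoiding_words_def admissible_Cons dim)+
  have lo: "real (card (avoiding_words T S k)) * \<delta> \<le> ?a k" for k
    unfolding total_weight_def using sum_bounded_below[of "avoiding_words T S k" \<delta>] wt by blast
  have hi: "?a k \<le> real (card (avoiding_words T S k)) * M" for k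
    unfolding total_weight_def using sum_bounded_above[of "avoiding_words T S k" _ M] wt by blast
  have a0: "?a k \<ge> 0" for k using lo[of k] \<delta>(2) by (meson less_imp_le mult_nonneg_nonneg of_nat_0_le_iff order.trans)
  have growth: "\<beta> * ?a k \<le> ?a (Suc k)" for k
  proof (induction k rule: less_induct)
    case (less k)
    have decay: "?a (k - i) * \<beta> ^ i \<le> ?a k" if "i \<le> k" for i
      using that
    proof (induction i)
      case (Suc i)
      have "?a (k - Suc i) * \<beta> ^ Suc i = (\<beta> * ?a (k - Suc i)) * \<beta> ^ i" by simp
      also have "\<dots> \<le> ?a (Suc (k - Suc i)) * \<beta> ^ i"
        using less[of "k - Suc i"] Suc.prems \<beta> by (intro mult_right_mono) auto
      also have "\<dots> = ?a (k - i) * \<beta> ^ i" using Suc.prems by (simp add: Suc_diff_Suc)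
      finally show ?case using Suc by simp
    qed simp
    have bad: "real (card (avoiding_words T S (Suc k - length s))) \<le> ?a k * \<beta> / (\<delta> * \<beta> ^ l)"
      if s: "s \<in> S" "length s \<le> Suc k" for s
    proof -
      obtain i where i: "length s = Suc i" using S(2)[OF s(1)] by (cases s) auto
      let ?c = "real (card (avoiding_words T S (k - i)))"
      have "?c * (\<delta> * \<beta> ^ l) \<le> ?c * (\<delta> * \<beta> ^ Suc i)"
        using \<beta> \<delta> S(3)[OF s(1)] i by (intro mult_left_mono power_increasing) auto
      also have "\<dots> = (?c * \<delta>) * \<beta> ^ i * \<beta>" by simp
      also have "\<dots> \<le> ?a (k - i) * \<beta> ^ i * \<beta>"
        using lo \<beta> by (intro mult_right_mono) auto
      also have "\<dots> \<le> ?a k * \<beta>" using decay s i \<beta> by (intro mult_right_mono) auto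
      finally show ?thesis using i \<beta> \<delta> by (simp add: pos_le_divide_eq)
    qed
    have "(\<Sum>s\<in>{s\<in>S. length s \<le> Suc k}. real (card (avoiding_words T S (Suc k - length s))))
        \<le> (\<Sum>s\<in>{s\<in>S. length s \<le> Suc k}. ?a k * \<beta> / (\<delta> * \<beta> ^ l))"
      using bad by (intro sum_mono) auto
    also have "\<dots> \<le> (\<Sum>s\<in>S. ?a k * \<beta> / (\<delta> * \<beta> ^ l))"
      using S a0 \<beta> \<delta> by (intro sum_mono2) auto
    finally have "M * (\<Sum>s\<in>{s\<in>S. length s \<le> Suc k}. real (card (avoiding_words T S (Suc k - length s))))
        \<le> M * (real (card S) * (?a k * \<beta> / (\<delta> * \<beta> ^ l)))"
      using M \<delta> by (intro mult_left_mono) auto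
    also have "\<dots> = (real (card S) * M * \<beta>) / (\<delta> * \<beta> ^ l) * ?a k" by simp
    also have "\<dots> \<le> (r - \<beta>) * ?a k"
      using few a0 \<beta> \<delta> by (intro mult_right_mono) (auto simp: pos_divide_le_eq mult_ac)
    finally show ?case
      using total_weight_step[OF T vpos vM sub n \<delta> S(1,2), of k] by (simp add: algebra_simps)
  qed
  have "\<delta> * \<beta> ^ m \<le> ?a m"
  proof (induction m)
    case 0
    have "avoiding_words T S 0 = {[]}" using S(2) by (auto simp: avoiding_words_def admissible_Nil)
    then show ?case by (simp add: total_weight_def word_weight_def)
  next
    case (Suc m)
    then have "\<beta> * (\<delta> * \<beta> ^ m) \<le> \<beta> * ?a m" using \<beta> by (intro mult_left_mono) auto
    then show ?case using growth[of m] by (simp add: mult_ac)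
  qed
  then show ?thesis using hi[of m] by (simp add: mult_ac)
qed

section \<open>Windows of bi-infinite sequences\<close>

definition window :: "(int \<Rightarrow> nat) \<Rightarrow> int \<Rightarrow> nat \<Rightarrow> nat list" where
  "window x a m = map (\<lambda>j. x (a + int j)) [0..<m]"

lemma length_window [simp]: "length (window x a m) = m"
  by (simp add: window_def)

lemma nth_window [simp]: "j < m \<Longrightarrow> window x a m ! j = x (a + int j)"
  by (simp add: window_def)

lemma window_add: "window x a (j + k) = window x a j @ window x (a + int j) k"
  by (rule nth_equalityI) (auto simp: nth_append algebra_simps)

lemma window_eq_iff: "window x a m = window y b m \<longleftrightarrow> (\<forall>j<m. x (a + int j) = y (b + int j))"
  by (auto simp: list_eq_iff_nth_eq)

lemma sublist_window:
  assumes "a \<le> b" "b + int k \<le> a + int m"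
  shows "sublist (window x b k) (window x a m)"
proof -
  define j where "j = nat (b - a)"
  have b: "b = a + int j" using assms by (simp add: j_def)
  have "m = j + (k + (m - j - k))" using assms b by linarith
  then have "window x a m = window x a j @ window x b k @ window x (b + int k) (m - j - k)"
    by (metis window_add b)
  then show ?thesis by (auto simp: sublist_def)
qed

lemma appears_in_iff_window: "appears_in w x \<longleftrightarrow> (\<exists>a. window x a (length w) = w)"
  by (auto simp: appears_in_def list_eq_iff_nth_eq)

lemma appears_in_if_sublist_window:
  assumes "sublist s (window x a m)"
  shows "appears_in s x"
proof -
  obtain p q where "window x a m = p @ s @ q" using assms by (auto simp: sublist_def)
  moreover from this have m: "m = length p + (length s + length q)"
    by (metis length_append length_window)
  ultimately have "window x (a + int (length p)) (length s) = s" by (simp add: window_add)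
  then show ?thesis unfolding appears_in_iff_window by blast
qed

lemma window_in_avoiding_words:
  assumes "x \<in> avoiding (sft T) S"
  shows "window x a m \<in> avoiding_words T S m"
proof -
  have x: "x i < dim_row T" "T $$ (x (i + 1), x i) = 1" for i
    using assms by (auto simp: avoiding_def sft_def)
  have "T $$ (window x a m ! Suc k, window x a m ! k) = 1" if "Suc k < m" for k
    using x(2)[of "a + int k"] that by (simp add: ac_simps)
  moreover have "\<not> sublist s (window x a m)" if "s \<in> S" for s
    using assms that appears_in_if_sublist_window by (auto simp: avoiding_def)
  ultimately show ?thesis using x(1) by (auto simp: avoiding_words_def admissible_def window_def)
qed

text \<open>
  Every window lies in one of these, so a sequence of growing windows suffices. Their shape, a block
  of length \<open>m\<close> with margins \<open>p\<close>, is the one that the compactness argument below produces.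
\<close>

lemma mem_avoiding_sft_if_windows_avoiding:
  assumes "\<And>p. window x (- int p) (2 * p + m) \<in> avoiding_words T S (2 * p + m)"
  shows "x \<in> avoiding (sft T) S"
proof -
  have good: "window x a k \<in> avoiding_words T S k" for a k
  proof -
    define p where "p = nat \<bar>a\<bar> + k"
    have "sublist (window x a k) (window x (- int p) (2 * p + m))"
      by (rule sublist_window) (auto simp: p_def)
    then show ?thesis using avoiding_words_sublist[OF assms] by (metis length_window)
  qed
  have "x i < dim_row T \<and> T $$ (x (i + 1), x i) = 1" for i
    using good[of i 2] by (auto simp: avoiding_words_def admissible_def window_def numeral_2_eq_2)
  moreover have "\<not> appears_in s x" if "s \<in> S" for s
  proof
    assume "appears_in s x"
    then obtain a where "window x a (length s) = s" by (auto simp: appears_in_iff_window)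
    then have "s \<in> avoiding_words T S (length s)" using good by metis
    then show False using that by (auto simp: avoiding_words_def)
  qed
  ultimately show ?thesis by (simp add: avoiding_def sft_def)
qed

section \<open>Compactness of subshifts\<close>

text \<open>
  Such a set is a union of basic open sets of the product topology, and so is its complement.
\<close>

lemma clopen_of_finitely_many_coordinates:
  fixes K :: "('i \<Rightarrow> 'a::discrete_topology) set"
  assumes I: "finite I" and dep: "\<And>x y. \<forall>i\<in>I. x i = y i \<Longrightarrow> x \<in> K \<Longrightarrow> y \<in> K"
  shows "open K" "closed K"
proof -
  have op: "open L" if L: "\<And>x y. \<forall>i\<in>I. x i = y i \<Longrightarrow> x \<in> L \<Longrightarrow> y \<in> L" for L :: "('i \<Rightarrow> 'a) set"
    unfolding open_subopen[of L]
  proof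
    fix x assume x: "x \<in> L"
    let ?B = "Pi\<^sub>E UNIV (\<lambda>i. if i \<in> I then {x i} else UNIV)"
    have "open ?B"
      using I by (intro open_PiE) (auto simp: open_discrete intro: finite_subset[OF _ I])
    moreover have "x \<in> ?B" by auto
    moreover have "?B \<subseteq> L"
    proof
      fix y assume "y \<in> ?B"
      then have "\<forall>i\<in>I. x i = y i" by (auto simp: PiE_iff split: if_splits)
      then show "y \<in> L" using L x by blast
    qed
    ultimately show "\<exists>B. open B \<and> x \<in> B \<and> B \<subseteq> L" by blast
  qed
  show "open K" using op dep by blast
  have "open (- K)" by (rule op) (metis ComplD ComplI dep)
  then show "closed K" by (simp add: closed_def)
qed

lemma compact_bounded_sequences: "compact {x :: 'i \<Rightarrow> nat. \<forall>i. x i < n}"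
proof -
  have "compactin (product_topology (\<lambda>_. euclidean) UNIV) (Pi\<^sub>E UNIV (\<lambda>_::'i. {..<n}))"
    by (simp add: compactin_PiE finite_imp_compact)
  moreover have "Pi\<^sub>E UNIV (\<lambda>_::'i. {..<n}) = {x. \<forall>i. x i < n}" by auto
  ultimately show ?thesis by (simp add: euclidean_product_topology)
qed

lemma compact_avoiding_sft: "compact (avoiding (sft T) S)"
proof -
  let ?\<Omega> = "{x :: int \<Rightarrow> nat. \<forall>i. x i < dim_row T}"
  have "avoiding (sft T) S = ?\<Omega> \<inter> ((\<Inter>i. {x. T $$ (x (i + 1), x i) = 1}) \<inter>
      (\<Inter>s\<in>S. \<Inter>i. {x. \<not> (\<forall>k<length s. x (i + int k) = s ! k)}))"
    by (auto simp: avoiding_def sft_def appears_in_def)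
  moreover have "closed {x :: int \<Rightarrow> nat. T $$ (x (i + 1), x i) = 1}" for i
    by (rule clopen_of_finitely_many_coordinates(2)[of "{i, i + 1}"]) auto
  moreover have "closed {x :: int \<Rightarrow> nat. \<not> (\<forall>k<length s. x (i + int k) = s ! k)}" for i s
    by (rule clopen_of_finitely_many_coordinates(2)[of "(\<lambda>k. i + int k) ` {..<length s}"]) auto
  ultimately show ?thesis
    by (simp only:) (intro compact_Int_closed compact_bounded_sequences closed_Int closed_INT ballI)
qed

section \<open>Locally and globally admissible words\<close>

definition language :: "(int \<Rightarrow> nat) set \<Rightarrow> nat \<Rightarrow> nat list set" where
  "language X m = (\<lambda>x. window x 0 m) ` X"

lemma language_subset_avoiding_words: "language (avoiding (sft T) S) m \<subseteq> avoiding_words T S m"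
  by (auto simp: language_def window_in_avoiding_words)

text \<open>
  A long avoiding word may have no avoiding continuation to a bi-infinite sequence, but its
  middle block of length \<open>m\<close> does occur in a point of the subshift once the margins \<open>p\<close> on both
  sides are long enough. Otherwise, for each \<open>p\<close> the set of sequences with an avoiding window on
  \<open>{-p..<p+m}\<close> whose middle block is not in the language would be nonempty. These sets are closed and
  decreasing, so compactness provides a common point. It lies in the subshift, contradiction.
\<close>

lemma middle_of_long_avoiding_word_in_language:
  obtains p where "\<And>w. w \<in> avoiding_words T S (2 * p + m) \<Longrightarrow>
    take m (drop p w) \<in> language (avoiding (sft T) S) m"
proof (rule ccontr)
  let ?L = "language (avoiding (sft T) S) m"
  assume "\<not> thesis"
  with that have ex: "\<exists>w\<in>avoiding_words T S (2 * p + m). take m (drop p w) \<notin> ?L" for p by blast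
  \<comment> \<open>The letter 0, which fills the positions outside a word, is always allowed here.\<close>
  let ?\<Omega> = "{x :: int \<Rightarrow> nat. \<forall>i. x i < dim_row T \<or> x i < 1}"
  define K where "K p = {x. window x (- int p) (2 * p + m) \<in> avoiding_words T S (2 * p + m)
      \<and> window x 0 m \<notin> ?L}" for p
  have closed: "closed (K p)" for p
  proof (rule clopen_of_finitely_many_coordinates(2))
    let ?I = "{- int p..<int p + int m}"
    show "finite ?I" by simp
    fix x y :: "int \<Rightarrow> nat" assume eq: "\<forall>i\<in>?I. x i = y i" and x: "x \<in> K p"
    have "window x (- int p) (2 * p + m) = window y (- int p) (2 * p + m)" "window x 0 m = window y 0 m"
      using eq by (auto simp: window_eq_iff)
    then show "y \<in> K p" using x by (simp add: K_def)
  qed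
  have anti: "K q \<subseteq> K p" if "p \<le> q" for p q
  proof
    fix x assume x: "x \<in> K q"
    have "sublist (window x (- int p) (2 * p + m)) (window x (- int q) (2 * q + m))"
      using that by (intro sublist_window) auto
    then show "x \<in> K p" using x avoiding_words_sublist by (fastforce simp: K_def)
  qed
  have nonempty: "?\<Omega> \<inter> K p \<noteq> {}" for p
  proof -
    obtain w where w: "w \<in> avoiding_words T S (2 * p + m)" "take m (drop p w) \<notin> ?L" using ex by blast
    define x where "x i = (if 0 \<le> i + int p \<and> i + int p < int (length w)
        then w ! nat (i + int p) else 0)" for i
    have len: "length w = 2 * p + m" using w by (simp add: avoiding_words_def)
    have "window x (- int p) (2 * p + m) = w" "window x 0 m = take m (drop p w)"
      by (auto simp: list_eq_iff_nth_eq len x_def nat_add_distrib add.commute)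
    moreover have "x \<in> ?\<Omega>"
      using w by (auto simp: x_def avoiding_words_def admissible_def all_set_conv_all_nth)
    ultimately have "x \<in> ?\<Omega> \<inter> K p" using w by (simp add: K_def)
    then show ?thesis by blast
  qed
  have "compact {x :: int \<Rightarrow> nat. \<forall>i. x i < max (dim_row T) 1}" by (rule compact_bounded_sequences)
  then have comp: "compact ?\<Omega>" by (simp add: less_max_iff_disj)
  have "?\<Omega> \<inter> (\<Inter>p. K p) \<noteq> {}"
  proof (rule compact_imp_fip_image[OF comp])
    fix F :: "nat set" assume F: "finite F"
    have "K (Max (insert 0 F)) \<subseteq> (\<Inter>p\<in>F. K p)" using F by (intro INT_greatest anti) auto
    then show "?\<Omega> \<inter> (\<Inter>p\<in>F. K p) \<noteq> {}" using nonempty[of "Max (insert 0 F)"] by blast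
  qed (use closed in auto)
  then obtain x where x: "\<And>p. x \<in> K p" by auto
  then have "x \<in> avoiding (sft T) S"
    by (intro mem_avoiding_sft_if_windows_avoiding[of _ m]) (simp add: K_def)
  then have "window x 0 m \<in> ?L" by (simp add: language_def)
  then show False using x by (simp add: K_def)
qed

text \<open>
  The passage from avoiding words to the language of the subshift costs nothing in the growth
  rate. Cut an avoiding word of length \<open>2 p + q m\<close> into two margins of length \<open>p\<close> and \<open>q\<close> blocks of
  length \<open>m\<close>. Each block is the middle of an avoiding word of length \<open>2 p + m\<close>, hence in the
  language for a suitable \<open>p\<close>. So \<open>\<beta> ^ (2 p + q m)\<close> is at most a constant times the
  \<open>q\<close>-th power of the number of words of length \<open>m\<close> in the language. Letting \<open>q\<close> tend to infinity removes all constants.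
\<close>

lemma card_language_lower:
  assumes c: "c > 0" and \<beta>: "\<beta> > 0" and lower: "\<And>k. c * \<beta> ^ k \<le> real (card (avoiding_words T S k))"
  shows "\<beta> ^ m \<le> real (card (language (avoiding (sft T) S) m))"
proof (rule ccontr)
  let ?G = "avoiding_words T S" and ?L = "language (avoiding (sft T) S) m"
  have finL: "finite ?L" using finite_subset[OF language_subset_avoiding_words finite_avoiding_words] .
  obtain p where p: "\<And>w. w \<in> ?G (2 * p + m) \<Longrightarrow> take m (drop p w) \<in> ?L"
    using middle_of_long_avoiding_word_in_language[where T = T and S = S and m = m] by metis
  define D where "D q = (\<lambda>w. take (q * m) (drop p w)) ` ?G (2 * p + q * m)" for q
  have finD: "finite (D q)" for q by (simp add: D_def finite_avoiding_words)
  have piece: "take k (drop j w) \<in> ?G k" if "w \<in> ?G l" "j + k \<le> l" for w j k l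
  proof -
    have "sublist (take k (drop j w)) w"
      by (meson sublist_drop sublist_order.order.trans sublist_take)
    then show ?thesis using avoiding_words_sublist[OF that(1)] that by (fastforce simp: avoiding_words_def)
  qed
  have cardD: "card (D q) \<le> card ?L ^ q" for q
  proof (induction q)
    case 0
    have "card (D 0) \<le> card {[] :: nat list}" by (intro card_mono) (auto simp: D_def)
    then show ?case by simp
  next
    case (Suc q)
    have "D (Suc q) \<subseteq> (\<lambda>(u, v). u @ v) ` (?L \<times> D q)"
    proof
      fix z assume "z \<in> D (Suc q)"
      then obtain w where w: "w \<in> ?G (2 * p + Suc q * m)" and z: "z = take (Suc q * m) (drop p w)"
        by (auto simp: D_def)
      have "take m (drop p (take (2 * p + m) (drop 0 w))) \<in> ?L"
        by (intro p piece[OF w]) simp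
      moreover have "take m (drop p (take (2 * p + m) (drop 0 w))) = take m (drop p w)"
        by (simp add: drop_take min_def)
      moreover have "take (2 * p + q * m) (drop m w) \<in> ?G (2 * p + q * m)"
        by (rule piece[OF w]) simp
      then have "take (q * m) (drop p (take (2 * p + q * m) (drop m w))) \<in> D q"
        unfolding D_def by blast
      then have "take (q * m) (drop m (drop p w)) \<in> D q"
        by (simp add: drop_take min_def add.commute)
      moreover have "z = take m (drop p w) @ take (q * m) (drop m (drop p w))"
        unfolding z by (simp only: mult_Suc take_add)
      ultimately show "z \<in> (\<lambda>(u, v). u @ v) ` (?L \<times> D q)" by auto
    qed
    then have "card (D (Suc q)) \<le> card (?L \<times> D q)"
      using finL finD by (meson card_image_le card_mono finite_SigmaI finite_imageI le_trans)
    also have "\<dots> \<le> card ?L * card ?L ^ q" using Suc by (simp add: card_cartesian_product)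
    finally show ?case by simp
  qed
  have cardG: "card (?G (2 * p + q * m)) \<le> (card (?G p))\<^sup>2 * card ?L ^ q" for q
  proof -
    have "?G (2 * p + q * m) \<subseteq> (\<lambda>(x, y, z). x @ y @ z) ` (?G p \<times> D q \<times> ?G p)"
    proof
      fix w assume w: "w \<in> ?G (2 * p + q * m)"
      let ?x = "take p w" and ?y = "take (q * m) (drop p w)" and ?z = "drop (q * m) (drop p w)"
      have len: "length w = 2 * p + q * m" using w by (simp add: avoiding_words_def)
      have "?x \<in> ?G p" using piece[OF w, of 0 p] by simp
      moreover have "?y \<in> D q" using w by (auto simp: D_def)
      moreover have "take p (drop (p + q * m) w) \<in> ?G p" by (rule piece[OF w]) simp
      then have "?z \<in> ?G p" using len by (simp add: add.commute)
      moreover have "w = ?x @ ?y @ ?z" by (simp del: drop_drop)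
      ultimately show "w \<in> (\<lambda>(x, y, z). x @ y @ z) ` (?G p \<times> D q \<times> ?G p)" by force
    qed
    then have "card (?G (2 * p + q * m)) \<le> card (?G p \<times> D q \<times> ?G p)"
      using finite_avoiding_words finD by (meson card_image_le card_mono finite_SigmaI finite_imageI le_trans)
    also have "\<dots> = (card (?G p))\<^sup>2 * card (D q)"
      by (simp add: card_cartesian_product power2_eq_square)
    also have "\<dots> \<le> (card (?G p))\<^sup>2 * card ?L ^ q" using cardD by (intro mult_left_mono) auto
    finally show ?thesis .
  qed
  assume "\<not> \<beta> ^ m \<le> real (card ?L)"
  then have "real (card ?L) / \<beta> ^ m < 1" using \<beta> by simp
  \<comment> \<open>The summand 1 only makes \<open>A\<close> positive.\<close>
  moreover define A where "A = (real (card (?G p)))\<^sup>2 + 1"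
  have A: "A > 0" by (simp add: A_def add_nonneg_pos)
  ultimately obtain q where "(real (card ?L) / \<beta> ^ m) ^ q < c * \<beta> ^ (2 * p) / A"
    using real_arch_pow_inv[of "c * \<beta> ^ (2 * p) / A"] c \<beta> by (metis divide_pos_pos mult_pos_pos zero_less_power)
  then have "A * real (card ?L) ^ q < c * \<beta> ^ (2 * p) * (\<beta> ^ m) ^ q"
    using A \<beta> by (simp add: power_divide field_simps)
  also have "\<dots> = c * \<beta> ^ (2 * p + q * m)" by (simp add: power_add power_mult mult.commute[of q])
  also have "\<dots> \<le> real (card (?G (2 * p + q * m)))" by (rule lower)
  also have "\<dots> \<le> real ((card (?G p))\<^sup>2 * card ?L ^ q)" using cardG by (rule of_nat_mono)
  also have "\<dots> \<le> A * real (card ?L) ^ q" by (simp add: A_def algebra_simps)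
  finally show False by simp
qed

section \<open>Entropy and the language of a subshift\<close>

lemma funpow_shift_map: "(shift_map ^^ j) x = (\<lambda>i. x (i + int j))"
  by (induction j) (auto simp: shift_map_def algebra_simps)

lemma funpow_shift_map_in:
  assumes "shift_map ` X \<subseteq> X" "x \<in> X"
  shows "(shift_map ^^ j) x \<in> X"
  using assms by (induction j) auto

lemma shift_map_avoiding_sft: "shift_map ` avoiding (sft T) S \<subseteq> avoiding (sft T) S"
proof
  fix y assume "y \<in> shift_map ` avoiding (sft T) S"
  then obtain x where x: "x \<in> avoiding (sft T) S" and y: "y = shift_map x" by blast
  have "window y a m = window x (a + 1) m" for a m
    by (simp add: y shift_map_def window_eq_iff algebra_simps)
  then show "y \<in> avoiding (sft T) S"
    by (intro mem_avoiding_sft_if_windows_avoiding[of _ 0]) (simp add: window_in_avoiding_words[OF x])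
qed

lemma iterated_joinI:
  assumes "\<And>j. j < k \<Longrightarrow> c j \<in> \<U>"
  shows "{x \<in> topspace X. \<forall>j<k. (f ^^ j) x \<in> c j} \<in> iterated_join X f \<U> k"
  using assms unfolding iterated_join_def by blast

text \<open>
  The cover by the zeroth coordinate is a partition. Members of its \<open>k\<close>-th join are sets of points
  with a common word on \<open>{0..<k}\<close>, so a subcover needs one member for each word of length \<open>k\<close>.
\<close>

lemma shift_entropy_lower:
  assumes inv: "shift_map ` X \<subseteq> X" and fin: "\<And>k. finite (language X k)"
    and \<beta>: "\<beta> > 0" and lower: "\<And>k. \<beta> ^ k \<le> real (card (language X k))"
  shows "ereal (ln \<beta>) \<le> shift_entropy X"
proof -
  define \<U> where "\<U> = range (\<lambda>a. {x \<in> X. x 0 = a})"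
  have "openin (top_of_set X) {x \<in> X. x 0 = a}" for a
  proof -
    have "open {x :: int \<Rightarrow> nat. x 0 = a}"
      by (rule clopen_of_finitely_many_coordinates(1)[of "{0}"]) auto
    then show ?thesis by (auto simp: openin_open)
  qed
  then have cover: "open_cover (top_of_set X) \<U>"
    by (auto simp: open_cover_def \<U>_def)
  have count: "card (language X k) \<le> min_subcover_card (top_of_set X) (iterated_join (top_of_set X) shift_map \<U> k)"
    for k
  proof -
    let ?J = "iterated_join (top_of_set X) shift_map \<U> k"
    let ?P = "\<lambda>m. \<exists>\<V>\<subseteq>?J. finite \<V> \<and> \<Union>\<V> = topspace (top_of_set X) \<and> card \<V> = m"
    let ?V = "(\<lambda>u. {x \<in> X. window x 0 k = u}) ` language X k"
    have "?V \<subseteq> ?J"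
    proof
      fix V assume "V \<in> ?V"
      then obtain u where u: "u \<in> language X k" and V: "V = {x \<in> X. window x 0 k = u}" by blast
      have len: "length u = k" using u by (auto simp: language_def)
      have "(shift_map ^^ j) x \<in> {y \<in> X. y 0 = u ! j} \<longleftrightarrow> x (int j) = u ! j" if "x \<in> X" for x j
        using funpow_shift_map_in[OF inv that, of j] by (simp add: funpow_shift_map)
      then have "V = {x \<in> X. \<forall>j<k. (shift_map ^^ j) x \<in> {y \<in> X. y 0 = u ! j}}"
        using len unfolding V by (auto simp: list_eq_iff_nth_eq)
      moreover have "{x \<in> topspace (top_of_set X). \<forall>j<k. (shift_map ^^ j) x \<in> {y \<in> X. y 0 = u ! j}} \<in> ?J"
        by (rule iterated_joinI) (simp add: \<U>_def)
      ultimately show "V \<in> ?J" by simp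
    qed
    moreover have "\<Union>?V = X" by (auto simp: language_def)
    moreover have "finite ?V" using fin by simp
    ultimately have "?P (card ?V)" by auto
    then have "?P (min_subcover_card (top_of_set X) ?J)"
      unfolding min_subcover_card_def by (rule LeastI)
    then obtain \<V> where \<V>: "\<V> \<subseteq> ?J" "finite \<V>" "\<Union>\<V> = X"
      and card: "card \<V> = min_subcover_card (top_of_set X) ?J" by auto
    have "\<exists>V x. V \<in> \<V> \<and> x \<in> V \<and> window x 0 k = u" if "u \<in> language X k" for u
      using that \<V>(3) by (auto simp: language_def)
    then obtain V x where Vx: "\<And>u. u \<in> language X k \<Longrightarrow> V u \<in> \<V> \<and> x u \<in> V u \<and> window (x u) 0 k = u"
      by metis
    have same: "window y 0 k = window z 0 k" if "W \<in> ?J" "y \<in> W" "z \<in> W" for W y z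
    proof -
      obtain c where c: "W = {x \<in> X. \<forall>j<k. (shift_map ^^ j) x \<in> c j}" "\<forall>j<k. c j \<in> \<U>"
        using \<open>W \<in> ?J\<close> by (auto simp: iterated_join_def)
      have "y (int j) = z (int j)" if "j < k" for j
      proof -
        have "c j \<in> \<U>" using c(2) that by blast
        then obtain a where a: "c j = {x \<in> X. x 0 = a}" by (auto simp: \<U>_def)
        have "(shift_map ^^ j) y \<in> c j" "(shift_map ^^ j) z \<in> c j"
          using c(1) \<open>y \<in> W\<close> \<open>z \<in> W\<close> that by auto
        then show ?thesis by (simp add: a funpow_shift_map)
      qed
      then show ?thesis by (simp add: window_eq_iff)
    qed
    have "inj_on V (language X k)"
    proof (rule inj_onI)
      fix u w assume "u \<in> language X k" "w \<in> language X k" "V u = V w"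
      then show "u = w" using same[of "V u" "x u" "x w"] Vx \<V>(1) by auto
    qed
    then have "card (language X k) \<le> card \<V>"
      by (rule card_inj_on_le) (use Vx \<V>(2) in auto)
    then show ?thesis by (simp add: card)
  qed
  have "ereal (ln \<beta>) \<le> cover_entropy (top_of_set X) shift_map \<U>"
    unfolding cover_entropy_def
  proof (rule le_Limsup)
    show "\<forall>\<^sub>F k in sequentially. ereal (ln \<beta>) \<le>
        ereal (ln (real (min_subcover_card (top_of_set X) (iterated_join (top_of_set X) shift_map \<U> k))) / real k)"
      using eventually_gt_at_top[of 0]
    proof eventually_elim
      case (elim k)
      have "\<beta> ^ k \<le> real (min_subcover_card (top_of_set X) (iterated_join (top_of_set X) shift_map \<U> k))"
        using lower[of k] count[of k] by linarith
      moreover have "0 < \<beta> ^ k" using \<beta> by simp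
      ultimately have "ln (\<beta> ^ k) \<le> ln (real (min_subcover_card (top_of_set X) (iterated_join (top_of_set X) shift_map \<U> k)))"
        by (subst ln_le_cancel_iff) auto
      then show ?case using elim \<beta> by (simp add: ln_realpow pos_le_divide_eq mult.commute)
    qed
  qed simp
  also have "\<dots> \<le> shift_entropy X"
    unfolding shift_entropy_def topological_entropy_def by (rule SUP_upper) (simp add: cover)
  finally show ?thesis .
qed

text \<open>
  The Lebesgue number lemma, with closeness of sequences measured by a window on which they agree.
\<close>

lemma Lebesgue_window:
  fixes X :: "(int \<Rightarrow> nat) set"
  assumes X: "compact X" and cover: "open_cover (top_of_set X) \<U>"
  obtains p :: nat where "\<And>x. x \<in> X \<Longrightarrow> \<exists>U\<in>\<U>. \<forall>y\<in>X.
    (\<forall>i. \<bar>i\<bar> \<le> int p \<longrightarrow> y i = x i) \<longrightarrow> y \<in> U"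
proof -
  define C where "C p x = {y :: int \<Rightarrow> nat. \<forall>i. \<bar>i\<bar> \<le> int p \<longrightarrow> y i = x i}" for p :: nat and x
  have opC: "open (C p x)" for p x
    by (rule clopen_of_finitely_many_coordinates(1)[of "{- int p..int p}"]) (simp_all add: C_def abs_le_iff minus_le_iff)
  have "\<exists>p. \<exists>U\<in>\<U>. X \<inter> C p x \<subseteq> U" if x: "x \<in> X" for x
  proof -
    obtain U where U: "U \<in> \<U>" "x \<in> U" using cover x by (auto simp: open_cover_def)
    then obtain W where W: "open W" "U = X \<inter> W" using cover by (auto simp: open_cover_def openin_open)
    then have "openin (product_topology (\<lambda>_. euclidean) UNIV) W"
      by (simp add: euclidean_product_topology)
    from product_topology_open_contains_basis[OF this, of x] U W
    obtain B where B: "x \<in> Pi\<^sub>E UNIV B" "finite {i. B i \<noteq> UNIV}" "Pi\<^sub>E UNIV B \<subseteq> W" by auto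
    define p where "p = Max (insert 0 ((\<lambda>i. nat \<bar>i\<bar>) ` {i. B i \<noteq> UNIV}))"
    have p: "\<bar>i\<bar> \<le> int p" if "B i \<noteq> UNIV" for i
    proof -
      have "nat \<bar>i\<bar> \<le> p" unfolding p_def using B(2) that by (intro Max_ge) auto
      then show ?thesis by simp
    qed
    have "C p x \<subseteq> Pi\<^sub>E UNIV B"
    proof
      fix y assume y: "y \<in> C p x"
      have "y i \<in> B i" for i
        using p[of i] y B(1) by (cases "B i = UNIV") (auto simp: C_def PiE_iff)
      then show "y \<in> Pi\<^sub>E UNIV B" by auto
    qed
    then have "C p x \<subseteq> W" using B(3) by (rule subset_trans)
    then have "X \<inter> C p x \<subseteq> U" unfolding W(2) by (intro Int_mono subset_refl)
    then show ?thesis using U(1) by blast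
  qed
  then obtain q where q: "\<And>x. x \<in> X \<Longrightarrow> \<exists>U\<in>\<U>. X \<inter> C (q x) x \<subseteq> U" by metis
  have "X \<subseteq> (\<Union>x\<in>X. C (q x) x)" by (auto simp: C_def)
  then have "\<exists>F. F \<subseteq> X \<and> finite F \<and> X \<subseteq> (\<Union>x\<in>F. C (q x) x)"
    by (rule compactE_image[OF X, rotated]) (intro exI conjI, assumption+, rule opC)
  then obtain F where F: "F \<subseteq> X" "finite F" "X \<subseteq> (\<Union>x\<in>F. C (q x) x)" by (elim exE conjE)
  define p where "p = Max (insert 0 (q ` F))"
  have qp: "q z \<le> p" if "z \<in> F" for z unfolding p_def using F(2) that by (intro Max_ge) auto
  have "\<exists>U\<in>\<U>. \<forall>y\<in>X. (\<forall>i. \<bar>i\<bar> \<le> int p \<longrightarrow> y i = x i) \<longrightarrow> y \<in> U" if x: "x \<in> X" for x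
  proof -
    obtain z where z: "z \<in> F" "x \<in> C (q z) z" using F(3) x by blast
    then obtain U where U: "U \<in> \<U>" "X \<inter> C (q z) z \<subseteq> U" using q F(1) by blast
    have "y \<in> U" if "y \<in> X" "\<forall>i. \<bar>i\<bar> \<le> int p \<longrightarrow> y i = x i" for y
    proof -
      have "y \<in> C (q z) z" using that(2) z qp[OF z(1)] by (force simp: C_def)
      then show ?thesis using U(2) that(1) by blast
    qed
    then show ?thesis using U(1) by blast
  qed
  then show ?thesis using that by blast
qed

text \<open>
  Let \<open>p\<close> be a Lebesgue number for the cover. The window on \<open>{-p..<p+k}\<close> of a point decides for all
  \<open>j < k\<close> a member of the cover that contains its \<open>j\<close>-th shift. So the \<open>k\<close>-th join has a subcover with
  at most one member for each such window, and the margins do not affect the exponential rate.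
\<close>

lemma shift_entropy_upper:
  assumes X: "compact X" and inv: "shift_map ` X \<subseteq> X"
    and fin: "\<And>a k. finite ((\<lambda>x. window x a k) ` X)"
    and C: "C \<ge> 1" and \<rho>: "\<rho> \<ge> 1"
    and upper: "\<And>a k. real (card ((\<lambda>x. window x a k) ` X)) \<le> C * \<rho> ^ k"
  shows "shift_entropy X \<le> ereal (ln \<rho>)"
  unfolding shift_entropy_def topological_entropy_def
proof (rule SUP_least)
  fix \<U> assume "\<U> \<in> {\<U>. open_cover (top_of_set X) \<U>}"
  then have cover: "open_cover (top_of_set X) \<U>" by simp
  obtain p where "\<And>x. x \<in> X \<Longrightarrow> \<exists>U\<in>\<U>. \<forall>y\<in>X. (\<forall>i. \<bar>i\<bar> \<le> int p \<longrightarrow> y i = x i) \<longrightarrow> y \<in> U"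
    using Lebesgue_window[OF X cover] by metis
  then obtain U where U: "\<And>x. x \<in> X \<Longrightarrow> U x \<in> \<U>"
    and Uy: "\<And>x y. x \<in> X \<Longrightarrow> y \<in> X \<Longrightarrow> (\<And>i. \<bar>i\<bar> \<le> int p \<Longrightarrow> y i = x i) \<Longrightarrow> y \<in> U x"
    by metis
  let ?N = "\<lambda>k. min_subcover_card (top_of_set X) (iterated_join (top_of_set X) shift_map \<U> k)"
  have count: "?N k \<le> card ((\<lambda>x. window x (- int p) (2 * p + k)) ` X)" for k
  proof -
    let ?w = "\<lambda>x. window x (- int p) (2 * p + k)"
    let ?J = "iterated_join (top_of_set X) shift_map \<U> k"
    obtain g where g: "\<And>u. u \<in> ?w ` X \<Longrightarrow> g u \<in> X \<and> ?w (g u) = u"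
      by (metis (no_types, lifting) image_iff)
    define V where "V u = {x \<in> X. \<forall>j<k. (shift_map ^^ j) x \<in> U ((shift_map ^^ j) (g u))}" for u
    let ?V = "V ` ?w ` X"
    have "?V \<subseteq> ?J"
    proof
      fix W assume "W \<in> ?V"
      then obtain u where u: "u \<in> ?w ` X" and W: "W = V u" by blast
      have "{x \<in> topspace (top_of_set X). \<forall>j<k. (shift_map ^^ j) x \<in> U ((shift_map ^^ j) (g u))} \<in> ?J"
        using g[OF u] by (intro iterated_joinI U funpow_shift_map_in[OF inv]) simp
      then show "W \<in> ?J" by (simp add: W V_def)
    qed
    moreover have "x \<in> V (?w x)" if x: "x \<in> X" for x
    proof -
      have gx: "g (?w x) \<in> X" "?w (g (?w x)) = ?w x" using g x by auto
      have "(shift_map ^^ j) x \<in> U ((shift_map ^^ j) (g (?w x)))" if j: "j < k" for j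
      proof (rule Uy)
        fix i assume i: "\<bar>i\<bar> \<le> int p"
        define m where "m = nat (i + int j + int p)"
        have m: "m < 2 * p + k" "- int p + int m = i + int j" using i j by (simp_all add: m_def)
        then have "g (?w x) (- int p + int m) = x (- int p + int m)"
          using gx(2) unfolding window_eq_iff by blast
        then have "g (?w x) (i + int j) = x (i + int j)" by (simp only: m(2))
        then show "(shift_map ^^ j) x i = (shift_map ^^ j) (g (?w x)) i"
          by (simp add: funpow_shift_map)
      qed (use x gx funpow_shift_map_in[OF inv] in auto)
      then show ?thesis using x by (simp add: V_def)
    qed
    then have "\<Union>?V = X" by (auto simp: V_def)
    moreover have finV: "finite ?V" using fin by simp
    ultimately have "?N k \<le> card ?V"
      unfolding min_subcover_card_def by (intro Least_le exI[of _ ?V]) simp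
    also have "\<dots> \<le> card (?w ` X)" using fin by (intro card_image_le)
    finally show ?thesis .
  qed
  define D where "D = ln C + 2 * real p * ln \<rho>"
  have "cover_entropy (top_of_set X) shift_map \<U> \<le> limsup (\<lambda>k. ereal (D / real k + ln \<rho>))"
    unfolding cover_entropy_def
  proof (rule Limsup_mono)
    show "\<forall>\<^sub>F k in sequentially. ereal (ln (real (?N k)) / real k) \<le> ereal (D / real k + ln \<rho>)"
      using eventually_gt_at_top[of 0]
    proof eventually_elim
      case (elim k)
      have N: "real (?N k) \<le> C * \<rho> ^ (2 * p + k)"
        using count[of k] upper[of "- int p" "2 * p + k"] by linarith
      have "1 * 1 \<le> C * \<rho> ^ (2 * p + k)" using C \<rho> by (intro mult_mono one_le_power) auto
      then have "ln (real (?N k)) \<le> ln (C * \<rho> ^ (2 * p + k))"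
        using N by (cases "?N k = 0") auto
      also have "\<dots> = D + real k * ln \<rho>"
        using C \<rho> by (simp add: D_def ln_mult ln_realpow algebra_simps)
      finally show ?case using elim by (simp add: field_simps)
    qed
  qed
  also have "\<dots> = ereal (ln \<rho>)"
  proof (intro lim_imp_Limsup)
    have "(\<lambda>k. D / real k + ln \<rho>) \<longlonglongrightarrow> 0 + ln \<rho>"
      by (intro tendsto_add tendsto_const lim_const_over_n)
    then show "(\<lambda>k. ereal (D / real k + ln \<rho>)) \<longlonglongrightarrow> ereal (ln \<rho>)" by simp
  qed simp
  finally show "cover_entropy (top_of_set X) shift_map \<U> \<le> ereal (ln \<rho>)" .
qed

section \<open>Entropy of the perturbed subshifts\<close>

lemma shift_entropy_avoiding_le:
  assumes T: "zero_one_mat n T" and n: "n > 0" and le: "largest_eigenvalue T r" and r: "r > 1"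
  shows "shift_entropy (avoiding (sft T) S) \<le> ereal (ln r)"
proof (rule tendsto_lowerbound)
  show "((\<lambda>\<rho>. ereal (ln \<rho>)) \<longlongrightarrow> ereal (ln r)) (at_right r)"
    using r by (intro tendsto_intros) auto
  show "\<forall>\<^sub>F \<rho> in at_right r. shift_entropy (avoiding (sft T) S) \<le> ereal (ln \<rho>)"
    using eventually_at_right_less
  proof eventually_elim
    case (elim \<rho>)
    have \<rho>: "\<rho> > 0" "\<rho> \<ge> 1" using elim r by linarith+
    obtain C where C: "C > 0" "\<And>m. real (card (avoiding_words T {} m)) \<le> C * \<rho> ^ m"
      using card_admissible_words_upper[OF T n le elim \<rho>(1)] by metis
    let ?X = "avoiding (sft T) S"
    have sub: "(\<lambda>x. window x a k) ` ?X \<subseteq> avoiding_words T {} k" for a k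
      using window_in_avoiding_words[of _ T S a k] by (auto simp: avoiding_words_def)
    show ?case
    proof (rule shift_entropy_upper[of _ "max C 1"])
      fix a k
      show "finite ((\<lambda>x. window x a k) ` ?X)" using finite_subset[OF sub finite_avoiding_words] .
      have "real (card ((\<lambda>x. window x a k) ` ?X)) \<le> real (card (avoiding_words T {} k))"
        by (intro of_nat_mono card_mono finite_avoiding_words sub)
      also have "\<dots> \<le> max C 1 * \<rho> ^ k"
        using \<rho> by (intro order.trans[OF C(2)] mult_right_mono) auto
      finally show "real (card ((\<lambda>x. window x a k) ` ?X)) \<le> max C 1 * \<rho> ^ k" .
    qed (use \<rho> compact_avoiding_sft shift_map_avoiding_sft in auto)
  qed
qed simp

text \<open>
  The constant \<open>K\<close> depends only on the matrix. The uniformity in \<open>S\<close>, in the length bound \<open>l\<close> and in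
  \<open>\<beta>\<close> is what makes a limit along a sequence of forbidden sets possible.
\<close>

lemma shift_entropy_avoiding_ge:
  assumes T: "zero_one_mat n T" "irreducible_mat T" and le: "largest_eigenvalue T r" and r: "r > 1"
  obtains K where "K > 0" and "n > 0"
    and "\<And>S l \<beta>. finite S \<Longrightarrow> (\<And>s. s \<in> S \<Longrightarrow> s \<noteq> [] \<and> l \<le> length s) \<Longrightarrow> 1 \<le> \<beta> \<Longrightarrow> \<beta> \<le> r \<Longrightarrow>
      real (card S) \<le> (r - \<beta>) * K * \<beta> ^ l \<Longrightarrow> ereal (ln \<beta>) \<le> shift_entropy (avoiding (sft T) S)"
proof -
  have ev: "eigenvalue (map_mat complex_of_real T) (complex_of_real r)"
    using le by (simp add: largest_eigenvalue_def)
  obtain v where vpos: "\<And>a. a < n \<Longrightarrow> v a > 0"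
    and sub: "\<And>c. c < n \<Longrightarrow> r * v c \<le> (\<Sum>a<n. T $$ (c, a) * v a)" and n: "n > 0"
    by (rule exists_positive_subeigenvector[OF T ev]) (use r in simp, rule that)
  \<comment> \<open>The weight of the empty word is \<open>\<delta>\<close>, and \<open>M\<close> bounds the weight of every word.\<close>
  define M where "M = Max (v ` {..<n})"
  define \<delta> where "\<delta> = Min (v ` {..<n}) / r"
  have vM: "v a \<le> M" if "a < n" for a unfolding M_def using that by simp
  have M: "M > 0" using vM[OF n] vpos[OF n] by linarith
  have v\<delta>: "r * \<delta> \<le> v a" if "a < n" for a unfolding \<delta>_def using that r by simp
  have "0 < Min (v ` {..<n})" using vpos n by (subst Min_gr_iff) auto
  then have \<delta>: "\<delta> > 0" unfolding \<delta>_def using r by simp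
  have "ereal (ln \<beta>) \<le> shift_entropy (avoiding (sft T) S)"
    if S: "finite S" "\<And>s. s \<in> S \<Longrightarrow> s \<noteq> [] \<and> l \<le> length s" and \<beta>: "1 \<le> \<beta>" "\<beta> \<le> r"
      and few: "real (card S) \<le> (r - \<beta>) * (\<delta> / (M * r)) * \<beta> ^ l" for S :: "nat list set" and l \<beta>
  proof -
    have "real (card S) * M * \<beta> \<le> real (card S) * M * r"
      using \<beta> M by (intro mult_left_mono) auto
    also have "\<dots> \<le> (r - \<beta>) * (\<delta> / (M * r)) * \<beta> ^ l * (M * r)"
      using few M r by (simp only: mult.assoc[of "real _"]) (intro mult_right_mono, auto)
    also have "\<dots> = (r - \<beta>) * \<delta> * \<beta> ^ l" using M r by simp
    finally have few': "real (card S) * M * \<beta> \<le> (r - \<beta>) * \<delta> * \<beta> ^ l" .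
    have "\<delta> * \<beta> ^ m \<le> M * real (card (avoiding_words T S m))" for m
      by (rule card_avoiding_words_lower[OF T(1) vpos vM sub n v\<delta> \<delta> S(1) _ _ \<beta> few']) (use S(2) in auto)
    then have "\<delta> / M * \<beta> ^ m \<le> real (card (avoiding_words T S m))" for m
      using M by (simp add: pos_divide_le_eq mult.commute)
    then have "\<beta> ^ m \<le> real (card (language (avoiding (sft T) S) m))" for m
      using \<delta> M \<beta> by (intro card_language_lower[of "\<delta> / M"]) auto
    then show ?thesis
      using \<beta> shift_map_avoiding_sft finite_subset[OF language_subset_avoiding_words finite_avoiding_words]
      by (intro shift_entropy_lower) auto
  qed
  moreover have "\<delta> / (M * r) > 0" using \<delta> M r by simp
  ultimately show ?thesis using that n by blast
qed

text \<open>
  With no forbidden words, \<open>\<beta> = r\<close> is permitted in the lower bound.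
\<close>

lemma shift_entropy_sft:
  assumes T: "zero_one_mat n T" "irreducible_mat T" and le: "largest_eigenvalue T r" and r: "r > 1"
  shows "shift_entropy (sft T) = ereal (ln r)"
proof -
  obtain K where K: "K > 0" "n > 0"
    and ge: "\<And>S l \<beta>. finite S \<Longrightarrow> (\<And>s. s \<in> S \<Longrightarrow> s \<noteq> [] \<and> l \<le> length s) \<Longrightarrow> 1 \<le> \<beta> \<Longrightarrow> \<beta> \<le> r \<Longrightarrow>
      real (card S) \<le> (r - \<beta>) * K * \<beta> ^ l \<Longrightarrow> ereal (ln \<beta>) \<le> shift_entropy (avoiding (sft T) S)"
    using shift_entropy_avoiding_ge[OF assms] by metis
  have "avoiding (sft T) {} = sft T" by (simp add: avoiding_def)
  then show ?thesis
    using ge[of "{}" 0 r] shift_entropy_avoiding_le[OF T(1) K(2) le r, of "{}"] r by auto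
qed

theorem theorem2:
  fixes n :: nat and T :: "real mat" and r \<kappa> :: real
    and S :: "nat \<Rightarrow> nat list set" and \<l> :: "nat \<Rightarrow> nat"
  assumes "zero_one_mat n T"
    and "irreducible_mat T"
    and "largest_eigenvalue T r" and "r > 1"
    and "\<And>i. finite (S i)" and "\<And>i. S i \<noteq> {}"
    and "\<And>i w. w \<in> S i \<Longrightarrow> admissible T w \<and> w \<noteq> []"
    and "\<And>i v w. v \<in> S i \<Longrightarrow> w \<in> S i \<Longrightarrow> sublist v w \<Longrightarrow> v = w"
    and "\<And>i. \<l> i = Min (length ` S i)"
    and "filterlim \<l> at_top sequentially"
    and "0 < \<kappa>" and "\<kappa> < r"
    and "(\<lambda>i. real (card (S i))) \<in> O(\<lambda>i. \<kappa> ^ \<l> i)"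
  shows "(\<lambda>i. shift_entropy (avoiding (sft T) (S i))) \<longlonglongrightarrow> shift_entropy (sft T)"
proof -
  obtain K where K: "K > 0" "n > 0"
    and ge: "\<And>S l \<beta>. finite S \<Longrightarrow> (\<And>s. s \<in> S \<Longrightarrow> s \<noteq> [] \<and> l \<le> length s) \<Longrightarrow> 1 \<le> \<beta> \<Longrightarrow> \<beta> \<le> r \<Longrightarrow>
      real (card S) \<le> (r - \<beta>) * K * \<beta> ^ l \<Longrightarrow> ereal (ln \<beta>) \<le> shift_entropy (avoiding (sft T) S)"
    using shift_entropy_avoiding_ge[OF assms(1-4)] by metis
  obtain c where c: "c > 0" and card: "\<forall>\<^sub>F i in sequentially. real (card (S i)) \<le> c * \<kappa> ^ \<l> i"
    using landau_o.bigE[OF assms(13)] \<open>0 < \<kappa>\<close> by auto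
  have eventually_ge: "\<forall>\<^sub>F i in sequentially. ereal (ln \<beta>) \<le> shift_entropy (avoiding (sft T) (S i))"
    if \<beta>: "\<beta> > 1" "\<beta> > \<kappa>" "\<beta> < r" for \<beta>
  proof -
    have "(\<lambda>i. (\<kappa> / \<beta>) ^ \<l> i) \<longlonglongrightarrow> 0"
      using \<beta> \<open>0 < \<kappa>\<close> by (intro filterlim_compose[OF LIMSEQ_power_zero assms(10)]) auto
    moreover have "(r - \<beta>) * K / c > 0" using \<beta> K c by simp
    ultimately have "\<forall>\<^sub>F i in sequentially. (\<kappa> / \<beta>) ^ \<l> i < (r - \<beta>) * K / c"
      by (rule order_tendstoD)
    with card show ?thesis
    proof eventually_elim
      case (elim i)
      have "c * \<kappa> ^ \<l> i = c * (\<kappa> / \<beta>) ^ \<l> i * \<beta> ^ \<l> i"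
        using \<beta> by (simp add: power_divide)
      also have "\<dots> \<le> (r - \<beta>) * K * \<beta> ^ \<l> i"
        using elim(2) c \<beta> by (intro mult_right_mono) (auto simp: pos_less_divide_eq mult.commute)
      finally have "real (card (S i)) \<le> (r - \<beta>) * K * \<beta> ^ \<l> i" using elim(1) by linarith
      then show ?case
        using \<beta> assms(5,7,9) by (intro ge[of _ "\<l> i"]) auto
    qed
  qed
  have "(\<lambda>i. shift_entropy (avoiding (sft T) (S i))) \<longlonglongrightarrow> ereal (ln r)"
  proof (rule order_tendstoI)
    fix a assume "a < ereal (ln r)"
    moreover have "((\<lambda>\<beta>. ereal (ln \<beta>)) \<longlongrightarrow> ereal (ln r)) (at_left r)"
      using \<open>r > 1\<close> by (intro tendsto_intros) auto
    ultimately have "\<forall>\<^sub>F \<beta> in at_left r. a < ereal (ln \<beta>)"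
      by (intro order_tendstoD)
    moreover have "\<forall>\<^sub>F \<beta> in at_left r. \<beta> \<in> {max 1 \<kappa><..<r}"
      using \<open>r > 1\<close> \<open>\<kappa> < r\<close> by (intro eventually_at_left_real) auto
    ultimately have "\<forall>\<^sub>F \<beta> in at_left r. a < ereal (ln \<beta>) \<and> \<beta> \<in> {max 1 \<kappa><..<r}"
      by (rule eventually_conj)
    then obtain \<beta> where \<beta>: "a < ereal (ln \<beta>)" "\<beta> \<in> {max 1 \<kappa><..<r}"
      using eventually_happens' trivial_limit_at_left_real by blast
    have "\<forall>\<^sub>F i in sequentially. ereal (ln \<beta>) \<le> shift_entropy (avoiding (sft T) (S i))"
      using \<beta>(2) by (intro eventually_ge) auto
    then show "\<forall>\<^sub>F i in sequentially. a < shift_entropy (avoiding (sft T) (S i))"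
      by eventually_elim (use \<beta>(1) in order)
  next
    fix a assume "ereal (ln r) < a"
    then show "\<forall>\<^sub>F i in sequentially. shift_entropy (avoiding (sft T) (S i)) < a"
      using shift_entropy_avoiding_le[OF assms(1) K(2) assms(3,4)]
      by (intro always_eventually allI) (rule order.strict_trans1)
  qed
  then show ?thesis by (simp add: shift_entropy_sft[OF assms(1-4)])
qed

end
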